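(* Let $G_1=(V_1,E_1)$ and $G_2=(V_2,E_2)$ be trees with $V_1\cap V_2=\{v\}$ and $E_1\cap E_2=\varnothing$, and let the edges of $E_1\cup E_2$ carry distinct ranks. Let $D_1$ and $D_2$ be the single-linkage dendrograms of $G_1$ and $G_2$. For $i=1,2$, let $e_i^\star$ be the minimum-rank edge of $G_i$ incident to $v$, and let $S_i=\mathrm{spine}_{D_i}(e_i^\star)$; if $G_i$ is the single vertex $v$, set $S_i=\varnothing$. Let $S=S_1\cup S_2$. Define a parent function $p$ on $E_1\cup E_2$ as follows (the SLD-Merge procedure, which merges the two sorted spines as lists): - For $e\in E_i\setminus S$, $p(e)$ is the parent of $e$ in $D_i$. - For $e\in S$, $p(e)$ is the element of $S$ of smallest rank greater than $r_e$. - The maximum-rank element of $S$ is the root. Then $p$ is exactly the parent function of the single-linkage dendrogram of $G_1\cup G_2=(V_1\cup V_2,E_1\cup E_2)$.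
   Context: For a tree whose edges have distinct ranks $r_e$ (the position of $e$ in the order of edges sorted by weight, with ties broken consistently), the single-linkage dendrogram (SLD) is defined by the following process. Start with every vertex as a singleton cluster and process the edges in increasing order of rank; processing $e=(u,v)$ merges the current clusters of $u$ and $v$. The SLD is the rooted binary tree whose leaves are the vertices and whose internal nodes are the edges. The children of node $e$ represent the two clusters merged when $e$ is processed: a leaf for a singleton cluster, and otherwise the edge whose processing created that cluster. The parent of an internal node $e$ is the edge whose processing next merges the cluster created by $e$; the last edge processed is the root. The dendrogram is represented by the parent of each internal node, with leaves dropped. $\mathrm{spine}_D(e)$ is the set of internal nodes on the path from $e$ to the root of $D$, including both $e$ and the root; ranks strictly increase along it. The ranks on $E_1$ and on $E_2$ are the restrictions of the given rank order on $E_1\cup E_2$. *)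

theory Defs
  imports Main
begin

text \<open>
  A simple undirected graph is a pair \<open>(V, E)\<close> of a vertex set and a set of two-element subsets
  of \<open>V\<close>. The predicate \<open>tree\<close> of the AFP entry Graph\_Theory is not used because it only excludes
  directed cycles: an acyclically oriented triangle satisfies it.
\<close>

definition is_simple_graph :: "'a set \<Rightarrow> 'a set set \<Rightarrow> bool" where
  "is_simple_graph V E \<longleftrightarrow> finite V \<and> (\<forall>e\<in>E. e \<subseteq> V \<and> card e = 2)"

definition is_connected :: "'a set \<Rightarrow> 'a set set \<Rightarrow> bool" where
  "is_connected V E \<longleftrightarrow> V \<noteq> {} \<and> (\<forall>u\<in>V. \<forall>w\<in>V. (u, w) \<in> {(x, y). {x, y} \<in> E}\<^sup>*)"

definition is_cycle :: "'a set set \<Rightarrow> 'a list \<Rightarrow> bool" where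
  "is_cycle E xs \<longleftrightarrow> distinct xs \<and> 3 \<le> length xs \<and>
     (\<forall>i<length xs. {xs ! i, xs ! (Suc i mod length xs)} \<in> E)"

definition is_tree :: "'a set \<Rightarrow> 'a set set \<Rightarrow> bool" where
  "is_tree V E \<longleftrightarrow> is_simple_graph V E \<and> is_connected V E \<and> (\<nexists>xs. is_cycle E xs)"

datatype 'a sld_node = Leaf 'a | Inner "'a set"

text \<open>
  The state of the merging process is \<open>(A, par)\<close>: \<open>A\<close> is the set of current clusters, each paired
  with the dendrogram node representing it (a leaf for a singleton cluster, otherwise the edge whose
  processing created it), and \<open>par\<close> records the parents assigned so far, the value \<open>None\<close> meaning
  that there is none. Processing \<open>e\<close> merges the clusters that contain an endpoint of \<open>e\<close>; in a
  tree these are exactly two.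
\<close>

type_synonym 'a sld_state = "('a set \<times> 'a sld_node) set \<times> ('a sld_node \<Rightarrow> 'a set option)"

definition sld_init :: "'a set \<Rightarrow> 'a sld_state" where
  "sld_init V = ((\<lambda>u. ({u}, Leaf u)) ` V, (\<lambda>_. None))"

definition sld_step :: "'a set \<Rightarrow> 'a sld_state \<Rightarrow> 'a sld_state" where
  "sld_step e st =
     (let (A, par) = st;
          M = {(C, n). (C, n) \<in> A \<and> C \<inter> e \<noteq> {}}
      in ((A - M) \<union> {(\<Union>(fst ` M), Inner e)},
          \<lambda>n. if n \<in> snd ` M then Some e else par n))"

definition sld :: "'a set \<Rightarrow> 'a set set \<Rightarrow> ('a set \<Rightarrow> nat) \<Rightarrow> 'a sld_state" where
  "sld V E r = fold sld_step (sorted_key_list_of_set r E) (sld_init V)"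

text \<open>The dendrogram with leaves dropped; the root has parent \<open>None\<close>.\<close>

definition sld_parent :: "'a set \<Rightarrow> 'a set set \<Rightarrow> ('a set \<Rightarrow> nat) \<Rightarrow> 'a set \<Rightarrow> 'a set option" where
  "sld_parent V E r e = snd (sld V E r) (Inner e)"

definition spine :: "('a set \<Rightarrow> 'a set option) \<Rightarrow> 'a set \<Rightarrow> 'a set set" where
  "spine D e = {f. (e, f) \<in> {(x, y). D x = Some y}\<^sup>*}"

definition vertex_spine :: "'a set \<Rightarrow> 'a set set \<Rightarrow> ('a set \<Rightarrow> nat) \<Rightarrow> 'a \<Rightarrow> 'a set set" where
  "vertex_spine V E r v =
     (if V = {v} then {} else spine (sld_parent V E r) (arg_min_on r {e \<in> E. v \<in> e}))"

text \<open>
  The value is \<open>None\<close> outside \<open>E1 \<union> E2\<close>, as for \<^const>\<open>sld_parent\<close>, so that equality of the two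
  functions means equality on \<open>E1 \<union> E2\<close>.
\<close>

definition sld_merge ::
  "'a set \<Rightarrow> 'a set set \<Rightarrow> 'a set \<Rightarrow> 'a set set \<Rightarrow> ('a set \<Rightarrow> nat) \<Rightarrow> 'a \<Rightarrow> 'a set \<Rightarrow> 'a set option"
where
  "sld_merge V1 E1 V2 E2 r v e =
     (let S = vertex_spine V1 E1 r v \<union> vertex_spine V2 E2 r v
      in if e \<in> S then
           (if \<exists>f\<in>S. r e < r f then Some (arg_min_on r {f \<in> S. r e < r f}) else None)
         else if e \<in> E1 then sld_parent V1 E1 r e
         else if e \<in> E2 then sld_parent V2 E2 r e
         else None)"

end

theory Submission
  imports Defs
begin

text \<open>
  Write \<open>C(e)\<close> for the set of vertices joined to the edge \<open>e\<close> by edges of rank at most \<open>r e\<close>. The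
  parent of \<open>e\<close> in the dendrogram is the edge of least rank greater than \<open>r e\<close> that meets \<open>C(e)\<close>. Let
  \<open>S\<close> be the set of edges \<open>e\<close> with \<open>v \<in> C(e)\<close>. In every graph the parent of \<open>e \<in> S\<close> is the next
  element of \<open>S\<close>: an edge of higher rank meeting \<open>C(e)\<close> is again in \<open>S\<close>, and for \<open>f \<in> S\<close> of higher
  rank the first edge of rank above \<open>r e\<close> on a path from \<open>v\<close> through \<open>f\<close> meets \<open>C(e)\<close>. So \<open>S\<close> is the
  spine of the least edge at \<open>v\<close>. A path from a vertex of \<open>G\<^sub>1\<close> can leave \<open>G\<^sub>1\<close> only through \<open>v\<close>;
  hence the set \<open>S\<close> of \<open>G\<^sub>1 \<union> G\<^sub>2\<close> is \<open>S\<^sub>1 \<union> S\<^sub>2\<close>, and for an edge outside \<open>S\<close> gluing changes neither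
  \<open>C(e)\<close> nor the edges that meet it.
\<close>

section \<open>Edges of least rank, and spines as chains of successors\<close>

text \<open>With \<open>None\<close> on the empty set, the parent of an edge can be written as
  \<open>least_edge\<close> of its candidate parents, root included.\<close>

definition least_edge :: "('b \<Rightarrow> nat) \<Rightarrow> 'b set \<Rightarrow> 'b option" where
  "least_edge r T = (if T = {} then None else Some (arg_min_on r T))"

lemma least_edge_empty [simp]: "least_edge r {} = None"
  by (simp add: least_edge_def)

lemma least_edge_eq_None_iff [simp]: "least_edge r T = None \<longleftrightarrow> T = {}"
  by (simp add: least_edge_def)

lemma least_edge_SomeD:
  assumes "finite T" "least_edge r T = Some x"
  shows "x \<in> T" "\<And>y. y \<in> T \<Longrightarrow> r x \<le> r y"
  using assms arg_min_if_finite(1)[of T r] arg_min_least[of T _ r]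
  by (auto simp: least_edge_def split: if_splits)

lemma least_edge_eq_SomeI:
  assumes "finite T" "inj_on r T" "x \<in> T" "\<And>y. y \<in> T \<Longrightarrow> r x \<le> r y"
  shows "least_edge r T = Some x"
proof -
  obtain z where z: "least_edge r T = Some z"
    using assms(3) by (cases "least_edge r T") auto
  have "r z = r x"
    using least_edge_SomeD[OF assms(1) z] assms(3,4) by (simp add: antisym)
  then show ?thesis
    using z least_edge_SomeD(1)[OF assms(1) z] assms(2,3) by (auto dest: inj_onD)
qed

text \<open>Some element of \<open>T\<close> has rank at most the minimum of \<open>U\<close>, so
  the minima agree. This compares sets of candidate parents that may differ.\<close>

lemma least_edge_cofinal:
  assumes "finite U" "inj_on r U" "T \<subseteq> U" "\<And>f. f \<in> U \<Longrightarrow> \<exists>g\<in>T. r g \<le> r f"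
  shows "least_edge r T = least_edge r U"
proof (cases "least_edge r T")
  case None
  then have "U = {}" using assms(4) by auto
  with None show ?thesis by simp
next
  case (Some x)
  have "finite T" using assms(1,3) by (rule finite_subset[rotated])
  note x = least_edge_SomeD[OF this Some]
  have "r x \<le> r y" if "y \<in> U" for y
    using assms(4)[OF that] x(2) by (meson order_trans)
  then have "least_edge r U = Some x"
    using x(1) assms(1-3) by (intro least_edge_eq_SomeI) auto
  with Some show ?thesis by simp
qed

lemma least_edge_insert:
  assumes "finite T" "inj_on r T" "\<And>g. g \<in> T \<Longrightarrow> r g < r f"
  shows "least_edge r (insert f T) = (if T = {} then Some f else least_edge r T)"
proof (cases "T = {}")
  case True
  then show ?thesis by (auto intro!: least_edge_eq_SomeI)
next
  case False
  have "inj_on r (insert f T)" using assms(2,3) by (fastforce simp: inj_on_def)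
  then have "least_edge r T = least_edge r (insert f T)"
    using assms(1,3) False by (intro least_edge_cofinal) (auto intro: less_imp_le)
  with False show ?thesis by simp
qed

text \<open>Successors stay in \<open>S\<close>; conversely, each element other than
  \<open>m\<close> is the successor of its predecessor in \<open>S\<close>, so induction on the rank
  reaches it from \<open>m\<close>.\<close>

lemma spine_successor:
  assumes "finite S" "inj_on r S" "m \<in> S" "\<And>e. e \<in> S \<Longrightarrow> r m \<le> r e"
    and D: "\<And>e. e \<in> S \<Longrightarrow> D e = least_edge r {f \<in> S. r e < r f}"
  shows "spine D m = S"
proof
  have "f \<in> S" if "(m, f) \<in> {(x, y). D x = Some y}\<^sup>*" for f
    using that
  proof (induction rule: rtrancl_induct)
    case (step x y)
    then have "least_edge r {f \<in> S. r x < r f} = Some y" using D by simp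
    from least_edge_SomeD(1)[OF _ this] show ?case using assms(1) by simp
  qed (use assms(3) in simp)
  then show "spine D m \<subseteq> S" by (auto simp: spine_def)
next
  have "(m, e) \<in> {(x, y). D x = Some y}\<^sup>*" if "e \<in> S" for e
    using that
  proof (induction "r e" arbitrary: e rule: less_induct)
    case less
    show ?case
    proof (cases "e = m")
      case False
      let ?P = "{g \<in> S. r g < r e}"
      \<comment> \<open>This puts \<open>m\<close> into \<open>?P\<close>, so the maximum exists;
        the edge \<open>g\<close> attaining it is the predecessor of \<open>e\<close>.\<close>
      have "r m < r e"
        using False less.prems assms(2-4) by (metis inj_onD le_neq_implies_less)
      then have "Max (r ` ?P) \<in> r ` ?P"
        using assms(1,3) by (intro Max_in) auto
      then obtain g where g: "g \<in> S" "r g < r e" "r g = Max (r ` ?P)" by auto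
      have "r e \<le> r h" if "h \<in> S" "r g < r h" for h
      proof (rule ccontr)
        assume "\<not> r e \<le> r h"
        with that(1) have "r h \<le> Max (r ` ?P)" using assms(1) by (intro Max_ge) auto
        with that(2) g(3) show False by simp
      qed
      then have "D g = Some e"
        unfolding D[OF g(1)] using assms(1) inj_on_subset[OF assms(2)] g(2) less.prems
        by (intro least_edge_eq_SomeI) auto
      with less.hyps[OF g(2,1)] show ?thesis
        by (auto intro: rtrancl_into_rtrancl)
    qed simp
  qed
  then show "S \<subseteq> spine D m" by (auto simp: spine_def)
qed

section \<open>Reachability along edges of bounded rank, and clusters\<close>

definition reach :: "'a set set \<Rightarrow> ('a set \<Rightarrow> nat) \<Rightarrow> nat \<Rightarrow> ('a \<times> 'a) set" where
  "reach E r k = {(x, y). {x, y} \<in> E \<and> r {x, y} \<le> k}\<^sup>*"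

definition edge_cluster :: "'a set set \<Rightarrow> ('a set \<Rightarrow> nat) \<Rightarrow> 'a set \<Rightarrow> 'a set" where
  "edge_cluster E r e = reach E r (r e) `` e"

definition next_edges :: "'a set set \<Rightarrow> ('a set \<Rightarrow> nat) \<Rightarrow> 'a set \<Rightarrow> 'a set set" where
  "next_edges E r e = {f \<in> E. r e < r f \<and> f \<inter> edge_cluster E r e \<noteq> {}}"

text \<open>This turns out to be \<open>vertex_spine\<close>, described without reference to
  parents.\<close>

definition edges_reaching :: "'a set set \<Rightarrow> ('a set \<Rightarrow> nat) \<Rightarrow> 'a \<Rightarrow> 'a set set" where
  "edges_reaching E r v = {e \<in> E. v \<in> edge_cluster E r e}"

lemma reach_refl [simp]: "(x, x) \<in> reach E r k"
  by (simp add: reach_def)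

lemma reach_trans: "(x, y) \<in> reach E r k \<Longrightarrow> (y, z) \<in> reach E r k \<Longrightarrow> (x, z) \<in> reach E r k"
  unfolding reach_def by (rule rtrancl_trans)

lemma reach_sym: "(x, y) \<in> reach E r k \<Longrightarrow> (y, x) \<in> reach E r k"
proof -
  have "sym {(x, y). {x, y} \<in> E \<and> r {x, y} \<le> k}"
    by (auto simp: sym_def insert_commute)
  then show "(x, y) \<in> reach E r k \<Longrightarrow> (y, x) \<in> reach E r k"
    unfolding reach_def by (blast dest: sym_rtrancl symD)
qed

lemma reach_mono: "E \<subseteq> F \<Longrightarrow> k \<le> l \<Longrightarrow> (x, y) \<in> reach E r k \<Longrightarrow> (x, y) \<in> reach F r l"
  unfolding reach_def by (erule rtrancl_mono[THEN subsetD, rotated]) auto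

lemma reach_edge: "card e = 2 \<Longrightarrow> e \<in> E \<Longrightarrow> r e \<le> k \<Longrightarrow> x \<in> e \<Longrightarrow> y \<in> e \<Longrightarrow> (x, y) \<in> reach E r k"
  by (cases "x = y") (auto simp: reach_def card_2_iff insert_commute intro!: r_into_rtrancl)

text \<open>Path induction in invariant form; it replaces the choice of a first edge that leaves
  \<open>X\<close>.\<close>

lemma reach_closed:
  assumes "(x, y) \<in> reach E r k" "x \<in> X"
    and "\<And>a b. a \<in> X \<Longrightarrow> {a, b} \<in> E \<Longrightarrow> r {a, b} \<le> k \<Longrightarrow> b \<in> X"
  shows "y \<in> X"
  using assms(1,2) unfolding reach_def by (induction rule: rtrancl_induct) (auto intro: assms(3))

lemma edge_cluster_superset: "e \<subseteq> edge_cluster E r e"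
  unfolding edge_cluster_def using reach_refl by fast

lemma mem_edge_clusterE:
  assumes "y \<in> edge_cluster E r e"
  obtains x where "x \<in> e" "(y, x) \<in> reach E r (r e)"
proof -
  obtain x where "x \<in> e" "(x, y) \<in> reach E r (r e)"
    using assms by (auto simp: edge_cluster_def)
  with that reach_sym[OF this(2)] show thesis by blast
qed

lemma edge_cluster_connected:
  assumes "card e = 2" "e \<in> E" "x \<in> edge_cluster E r e" "y \<in> edge_cluster E r e"
  shows "(x, y) \<in> reach E r (r e)"
proof -
  obtain a b where "a \<in> e" "(a, x) \<in> reach E r (r e)" "b \<in> e" "(b, y) \<in> reach E r (r e)"
    using assms(3,4) by (auto simp: edge_cluster_def)
  with reach_edge[OF assms(1,2), of r "r e" a b] show ?thesis
    by (meson order_refl reach_sym reach_trans)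
qed

lemma edge_cluster_reach:
  "x \<in> edge_cluster E r e \<Longrightarrow> (x, y) \<in> reach E r (r e) \<Longrightarrow> y \<in> edge_cluster E r e"
  by (auto simp: edge_cluster_def intro: reach_trans)

text \<open>All of \<open>C(e)\<close> is connected by edges of rank at most \<open>r e\<close>,
  hence at most \<open>r f\<close>; one vertex shared with \<open>f\<close> brings in the whole
  cluster.\<close>

lemma edge_cluster_mono:
  assumes "card e = 2" "e \<in> E" "r e \<le> r f" "f \<inter> edge_cluster E r e \<noteq> {}"
  shows "edge_cluster E r e \<subseteq> edge_cluster E r f"
proof
  fix y assume y: "y \<in> edge_cluster E r e"
  obtain x where "x \<in> f" "x \<in> edge_cluster E r e" using assms(4) by auto
  with edge_cluster_connected[OF assms(1,2) this(2) y] assms(3)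
  show "y \<in> edge_cluster E r f"
    by (auto simp: edge_cluster_def intro: reach_mono)
qed

text \<open>Edges above \<open>r e\<close> do not enter the paths that define \<open>C(e)\<close>,
  so a cluster is final once its edge is processed.\<close>

lemma edge_cluster_insert:
  assumes "r e < r f"
  shows "edge_cluster (insert f E) r e = edge_cluster E r e"
proof -
  have "{(x, y). {x, y} \<in> insert f E \<and> r {x, y} \<le> r e} = {(x, y). {x, y} \<in> E \<and> r {x, y} \<le> r e}"
    using assms by auto
  then show ?thesis by (simp add: edge_cluster_def reach_def)
qed

lemma next_edges_insert:
  assumes "r e < r f"
  shows "next_edges (insert f E) r e =
    (if f \<inter> edge_cluster E r e \<noteq> {} then insert f (next_edges E r e) else next_edges E r e)"
  using assms by (auto simp: next_edges_def edge_cluster_insert)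

text \<open>Take the edge of highest rank whose cluster contains \<open>u\<close>: a next edge would
  absorb that cluster and contain \<open>u\<close> at a higher rank.\<close>

lemma ex_last_edge:
  assumes "finite E" "\<forall>e\<in>E. card e = 2" "u \<in> \<Union>E"
  obtains e where "e \<in> E" "u \<in> edge_cluster E r e" "next_edges E r e = {}"
proof -
  let ?P = "{e \<in> E. u \<in> edge_cluster E r e}"
  have "Max (r ` ?P) \<in> r ` ?P"
    using assms(1,3) edge_cluster_superset by (intro Max_in) fastforce+
  then obtain e where e: "e \<in> E" "u \<in> edge_cluster E r e" "r e = Max (r ` ?P)" by auto
  have "r f \<le> r e" if "f \<in> E" "u \<in> edge_cluster E r f" for f
    using that e(3) assms(1) by simp
  moreover have "u \<in> edge_cluster E r f" if "f \<in> next_edges E r e" for f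
    using that e(1,2) assms(2) edge_cluster_mono[of e E r f] by (auto simp: next_edges_def)
  ultimately have "next_edges E r e = {}"
    by (fastforce simp: next_edges_def)
  with e that show thesis by blast
qed

section \<open>The merging process in closed form\<close>

text \<open>The current clusters after processing \<open>E\<close>: an empty
  \<open>next_edges\<close> says that nothing processed since has merged the cluster of
  \<open>e\<close>.\<close>

definition sld_clusters :: "'a set \<Rightarrow> 'a set set \<Rightarrow> ('a set \<Rightarrow> nat) \<Rightarrow> ('a set \<times> 'a sld_node) set" where
  "sld_clusters V E r =
     {(edge_cluster E r e, Inner e) |e. e \<in> E \<and> next_edges E r e = {}} \<union>
     {({u}, Leaf u) |u. u \<in> V - \<Union>E}"

text \<open>A touched cluster is joined to \<open>f\<close> by edges of rank at most
  \<open>r f\<close>; conversely, the touched clusters cover \<open>f\<close>, and no edge of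
  \<open>insert f E\<close> leaves their union.\<close>

lemma Union_touched_clusters:
  assumes "finite E" "\<forall>e\<in>insert f E. e \<subseteq> V \<and> card e = 2" "\<forall>e\<in>E. r e < r f"
  shows "\<Union>(fst ` {(C, n). (C, n) \<in> sld_clusters V E r \<and> C \<inter> f \<noteq> {}}) =
    edge_cluster (insert f E) r f" (is "\<Union>(fst ` ?M) = _")
proof
  have "C \<subseteq> edge_cluster (insert f E) r f" if C: "(C, n) \<in> ?M" for C n
  proof (cases n)
    case (Leaf u)
    with C have "C \<subseteq> f" by (auto simp: sld_clusters_def)
    then show ?thesis using edge_cluster_superset by fastforce
  next
    case (Inner e)
    with C have "C = edge_cluster (insert f E) r e" "e \<in> E" "C \<inter> f \<noteq> {}"
      using assms(3) by (auto simp: sld_clusters_def edge_cluster_insert)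
    then show ?thesis using edge_cluster_mono[of e "insert f E" r f] assms(2,3)
      by (auto simp: Int_commute less_imp_le)
  qed
  then have "fst q \<subseteq> edge_cluster (insert f E) r f" if "q \<in> ?M" for q
    using that by (cases q) simp
  then show "\<Union>(fst ` ?M) \<subseteq> edge_cluster (insert f E) r f" by (rule UN_least)
next
  let ?X = "\<Union>(fst ` ?M)"
  have f: "f \<subseteq> ?X"
  proof
    fix u assume u: "u \<in> f"
    have "\<exists>C n. (C, n) \<in> sld_clusters V E r \<and> u \<in> C"
    proof (cases "u \<in> \<Union>E")
      case True
      then obtain e where "e \<in> E" "u \<in> edge_cluster E r e" "next_edges E r e = {}"
        using ex_last_edge assms(1,2) by (metis insert_iff)
      then show ?thesis by (auto simp: sld_clusters_def)
    next
      case False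
      with u assms(2) have "({u}, Leaf u) \<in> sld_clusters V E r" by (auto simp: sld_clusters_def)
      then show ?thesis by blast
    qed
    then obtain C n where C: "(C, n) \<in> sld_clusters V E r" "u \<in> C" by blast
    with u have "(C, n) \<in> ?M" by auto
    from imageI[OF this, of fst] C(2) show "u \<in> ?X" by (intro UnionI[of C]) simp_all
  qed
  have closed: "b \<in> ?X" if "a \<in> ?X" "{a, b} \<in> insert f E" for a b
  proof (cases "{a, b} = f")
    case True
    then show ?thesis using f by auto
  next
    case False
    with that have ab: "{a, b} \<in> E" by simp
    from that(1) obtain C where C: "C \<in> fst ` ?M" and aC: "a \<in> C" by (rule UnionE)
    from C obtain q where "C = fst q" "q \<in> ?M" by (rule imageE)
    then have "(C, snd q) \<in> ?M" by (simp only: prod.collapse)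
    \<comment> \<open>A leaf cluster contains no endpoint of an edge of \<open>E\<close>, so
      \<open>C\<close> comes from an edge \<open>e\<close>.\<close>
    with ab aC obtain e where e: "e \<in> E" "C = edge_cluster E r e" "next_edges E r e = {}"
      by (auto simp: sld_clusters_def)
    \<comment> \<open>Otherwise \<open>{a, b}\<close>, which meets \<open>C\<close> at
      \<open>a\<close>, would be a next edge of \<open>e\<close>.\<close>
    with ab aC have "r {a, b} \<le> r e"
      by (auto simp: next_edges_def not_less)
    then have "(a, b) \<in> reach E r (r e)"
      using ab assms(2) by (intro reach_edge[of "{a, b}"]) auto
    then have "b \<in> C" using edge_cluster_reach[of a E r e b] aC e(2) by simp
    with C show ?thesis by (rule UnionI)
  qed
  show "edge_cluster (insert f E) r f \<subseteq> ?X"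
  proof
    fix y assume "y \<in> edge_cluster (insert f E) r f"
    then obtain x where x: "x \<in> f" "(x, y) \<in> reach (insert f E) r (r f)"
      by (auto simp: edge_cluster_def)
    show "y \<in> ?X"
      by (rule reach_closed[OF x(2) subsetD[OF f x(1)]]) (rule closed)
  qed
qed

text \<open>An old cluster stops being current exactly when \<open>f\<close> meets it, and these
  clusters form the set \<open>M\<close> that the step removes.\<close>

lemma sld_clusters_insert:
  assumes "finite E" "\<forall>e\<in>insert f E. e \<subseteq> V \<and> card e = 2" "\<forall>e\<in>E. r e < r f"
  defines "M \<equiv> {(C, n). (C, n) \<in> sld_clusters V E r \<and> C \<inter> f \<noteq> {}}"
  shows "sld_clusters V (insert f E) r = sld_clusters V E r - M \<union> {(\<Union>(fst ` M), Inner f)}"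
proof -
  have last: "next_edges (insert f E) r f = {}"
    using assms(3) by (auto simp: next_edges_def)
  have old: "next_edges (insert f E) r e = {} \<longleftrightarrow>
      next_edges E r e = {} \<and> edge_cluster E r e \<inter> f = {}" if "e \<in> E" for e
    using that assms(3) by (auto simp: next_edges_insert)
  have inner: "(C, Inner e) \<in> sld_clusters V (insert f E) r \<longleftrightarrow>
      (C, Inner e) \<in> sld_clusters V E r - M \<or> e = f \<and> C = edge_cluster (insert f E) r f" for C e
  proof (cases "e \<in> E")
    case True
    then have "r e < r f" using assms(3) by blast
    with True show ?thesis
      by (simp add: sld_clusters_def M_def edge_cluster_insert old) blast
  next
    case False
    then show ?thesis using last by (auto simp: sld_clusters_def)
  qed
  have leaf: "(C, Leaf u) \<in> sld_clusters V (insert f E) r \<longleftrightarrow>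
      (C, Leaf u) \<in> sld_clusters V E r - M" for C u
    by (auto simp: sld_clusters_def M_def)
  have "(C, n) \<in> sld_clusters V (insert f E) r \<longleftrightarrow>
      (C, n) \<in> sld_clusters V E r - M \<union> {(edge_cluster (insert f E) r f, Inner f)}" for C n
    by (cases n) (auto simp: inner leaf simp del: Diff_iff)
  then show ?thesis
    unfolding M_def Union_touched_clusters[OF assms(1-3)] by auto
qed

text \<open>Induction on the processed prefix. The new edge is a candidate parent only for clusters
  it meets and, having the highest rank, becomes the parent only where there is none yet.\<close>

lemma fold_sld_step:
  assumes "sorted_wrt (\<lambda>e f. r e < r f) es" "\<forall>e\<in>set es. e \<subseteq> V \<and> card e = 2"
  shows "fst (fold sld_step es (sld_init V)) = sld_clusters V (set es) r \<and>
    (\<forall>e. snd (fold sld_step es (sld_init V)) (Inner e) =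
      (if e \<in> set es then least_edge r (next_edges (set es) r e) else None))"
  using assms
proof (induction es rule: rev_induct)
  case Nil
  then show ?case by (auto simp: sld_init_def sld_clusters_def)
next
  case (snoc f es)
  let ?E = "set es"
  obtain A par where st: "fold sld_step es (sld_init V) = (A, par)" by fastforce
  have less: "\<forall>e\<in>?E. r e < r f" and sorted: "sorted_wrt (\<lambda>e f. r e < r f) es"
    and edges: "\<forall>e\<in>insert f ?E. e \<subseteq> V \<and> card e = 2"
    using snoc.prems by (auto simp: sorted_wrt_append)
  have inj: "inj_on r ?E"
    using sorted by (induction es) auto
  have A: "A = sld_clusters V ?E r"
    and par: "par (Inner e) = (if e \<in> ?E then least_edge r (next_edges ?E r e) else None)" for e
    using snoc.IH[OF sorted] edges st by auto
  define M where "M = {(C, n). (C, n) \<in> A \<and> C \<inter> f \<noteq> {}}"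
  have step: "sld_step f (A, par) =
      (A - M \<union> {(\<Union>(fst ` M), Inner f)}, \<lambda>n. if n \<in> snd ` M then Some f else par n)"
    by (simp add: sld_step_def M_def Let_def)
  \<comment> \<open>A touched edge has empty \<open>next_edges\<close>, hence no parent so far; a
    parent once set is never overwritten.\<close>
  have touched: "Inner e \<in> snd ` M \<longleftrightarrow>
      e \<in> ?E \<and> next_edges ?E r e = {} \<and> edge_cluster ?E r e \<inter> f \<noteq> {}" for e
    by (auto simp: snd_eq_Range Range_iff M_def A sld_clusters_def)
  have "snd (fold sld_step (es @ [f]) (sld_init V)) (Inner e) =
      (if e \<in> insert f ?E then least_edge r (next_edges (insert f ?E) r e) else None)" for e
  proof (cases "e \<in> ?E")
    case True
    have sub: "next_edges ?E r e \<subseteq> ?E" by (auto simp: next_edges_def)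
    then have "least_edge r (insert f (next_edges ?E r e)) =
        (if next_edges ?E r e = {} then Some f else least_edge r (next_edges ?E r e))"
      using less inj_on_subset[OF inj] finite_subset[OF sub] by (intro least_edge_insert) auto
    with True less show ?thesis
      by (auto simp: st step touched par next_edges_insert Int_commute)
  next
    case False
    moreover have "next_edges (insert f ?E) r f = {}"
      using less by (auto simp: next_edges_def)
    ultimately show ?thesis by (auto simp: st step touched par)
  qed
  moreover have "fst (fold sld_step (es @ [f]) (sld_init V)) = sld_clusters V (insert f ?E) r"
    using sld_clusters_insert[OF _ edges less] by (simp add: st step) (simp add: M_def A)
  ultimately show ?case by simp
qed

lemma (in linorder) sorted_wrt_sorted_key_list_of_set:
  assumes "finite E" "inj_on r E"
  shows "set (sorted_key_list_of_set r E) = E"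
    and "sorted_wrt (\<lambda>e f. r e < r f) (sorted_key_list_of_set r E)"
proof -
  interpret folding_insort_key "(\<le>)" "(<)" E r
    by unfold_locales (rule assms(2))
  show "set (sorted_key_list_of_set r E) = E"
    using assms(1) by (rule set_sorted_key_list_of_set[OF subset_refl])
  have "sorted_wrt (<) (map r (sorted_key_list_of_set r E))"
    by (rule strict_sorted_key_list_of_set[OF subset_refl])
  then show "sorted_wrt (\<lambda>e f. r e < r f) (sorted_key_list_of_set r E)"
    by (simp add: sorted_wrt_map)
qed

lemma sld_parent_eq_least_edge:
  assumes "finite E" "\<forall>e\<in>E. e \<subseteq> V \<and> card e = 2" "inj_on r E"
  shows "sld_parent V E r e = (if e \<in> E then least_edge r (next_edges E r e) else None)"
  using fold_sld_step[of r "sorted_key_list_of_set r E" V] assms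
    sorted_wrt_sorted_key_list_of_set[OF assms(1,3)]
  by (simp add: sld_parent_def sld_def)

section \<open>The spine of a vertex\<close>

text \<open>The set on the right may be larger, since a later edge of the spine need not meet
  \<open>C(e)\<close>; below each of its elements there is still a next edge, so the minima
  agree.\<close>

lemma next_edge_edges_reaching:
  assumes "finite E" "\<forall>e\<in>E. card e = 2" "inj_on r E" "e \<in> edges_reaching E r v"
  shows "least_edge r (next_edges E r e) = least_edge r {f \<in> edges_reaching E r v. r e < r f}"
proof (rule least_edge_cofinal)
  have e: "e \<in> E" "v \<in> edge_cluster E r e" using assms(4) by (auto simp: edges_reaching_def)
  have "v \<in> edge_cluster E r f" if "f \<in> next_edges E r e" for f
    using that e assms(2) edge_cluster_mono[of e E r f] by (auto simp: next_edges_def)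
  then show "next_edges E r e \<subseteq> {f \<in> edges_reaching E r v. r e < r f}"
    by (auto simp: next_edges_def edges_reaching_def)
  fix f assume "f \<in> {f \<in> edges_reaching E r v. r e < r f}"
  then have f: "f \<in> E" "v \<in> edge_cluster E r f" "r e < r f" by (auto simp: edges_reaching_def)
  show "\<exists>g\<in>next_edges E r e. r g \<le> r f"
  proof (rule ccontr)
    assume none: "\<not> (\<exists>g\<in>next_edges E r e. r g \<le> r f)"
    obtain x where x: "x \<in> f" "(v, x) \<in> reach E r (r f)"
      using f(2) by (rule mem_edge_clusterE)
    \<comment> \<open>By \<open>none\<close> no edge of rank at most \<open>r f\<close> leaves
      \<open>C(e)\<close>, so the path from \<open>v\<close> to \<open>f\<close> ends inside it;
      then \<open>f\<close> itself is a next edge, a contradiction.\<close>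
    have "x \<in> edge_cluster E r e"
    proof (rule reach_closed[OF x(2) e(2)])
      fix a b assume ab: "a \<in> edge_cluster E r e" "{a, b} \<in> E" "r {a, b} \<le> r f"
      with none have "r {a, b} \<le> r e" by (fastforce simp: next_edges_def)
      then have "(a, b) \<in> reach E r (r e)"
        using ab assms(2) by (intro reach_edge[of "{a, b}"]) auto
      with ab(1) show "b \<in> edge_cluster E r e" by (rule edge_cluster_reach)
    qed
    with x(1) f none show False by (auto simp: next_edges_def)
  qed
qed (use assms(1) inj_on_subset[OF assms(3)] in \<open>auto simp: edges_reaching_def\<close>)

text \<open>The right-hand side is a chain of successors under \<open>sld_parent\<close>, so
  \<open>spine_successor\<close> applies once its least element is identified as the least edge at
  \<open>v\<close>.\<close>

lemma vertex_spine_eq_edges_reaching: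
  assumes "is_simple_graph V E" "is_connected V E" "inj_on r E" "v \<in> V"
  shows "vertex_spine V E r v = edges_reaching E r v"
proof (cases "V = {v}")
  case True
  have "\<not> (e \<subseteq> {v} \<and> card e = 2)" for e
    using card_mono[of "{v}" e] by auto
  with assms(1) True have "E = {}" by (auto simp: is_simple_graph_def)
  with True show ?thesis by (simp add: vertex_spine_def edges_reaching_def)
next
  case False
  have edges: "\<forall>e\<in>E. e \<subseteq> V \<and> card e = 2" and "finite V"
    using assms(1) by (auto simp: is_simple_graph_def)
  then have fin: "finite E" by (meson PowI finite_Pow_iff finite_subset subsetI)
  obtain w where "w \<in> V" "w \<noteq> v" using False assms(4) by auto
  moreover from this have "(v, w) \<in> {(x, y). {x, y} \<in> E}\<^sup>*"
    using assms(2,4) by (auto simp: is_connected_def)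
  ultimately have "\<exists>x. {v, x} \<in> E" by (auto elim: converse_rtranclE)
  then obtain m where m: "least_edge r {e \<in> E. v \<in> e} = Some m"
    by (cases "least_edge r {e \<in> E. v \<in> e}") auto
  note least = least_edge_SomeD[OF _ m]
  have "m \<in> edges_reaching E r v"
    using least(1) fin edge_cluster_superset[of m E r] by (auto simp: edges_reaching_def)
  moreover have "r m \<le> r e" if "e \<in> edges_reaching E r v" for e
  proof -
    have "e \<in> E" "v \<in> edge_cluster E r e" using that by (auto simp: edges_reaching_def)
    from this(2) obtain x where x: "x \<in> e" "(v, x) \<in> reach E r (r e)"
      by (rule mem_edge_clusterE)
    \<comment> \<open>Either \<open>v\<close> is the endpoint \<open>x\<close> of \<open>e\<close>,
      or the path from \<open>v\<close> to \<open>x\<close> starts with a suitable edge.\<close>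
    have "\<exists>f\<in>E. v \<in> f \<and> r f \<le> r e"
    proof (cases "x = v")
      case True
      with x \<open>e \<in> E\<close> show ?thesis by auto
    next
      case False
      with x(2) obtain y where "{v, y} \<in> E" "r {v, y} \<le> r e"
        unfolding reach_def by (cases rule: converse_rtranclE) auto
      then show ?thesis by auto
    qed
    then obtain f where "f \<in> E" "v \<in> f" "r f \<le> r e" by blast
    with least(2)[of f] fin show ?thesis by simp
  qed
  ultimately have "spine (sld_parent V E r) m = edges_reaching E r v"
    using fin inj_on_subset[OF assms(3)] edges assms(3)
    by (intro spine_successor[where r = r])
      (auto simp: sld_parent_eq_least_edge next_edge_edges_reaching edges_reaching_def)
  moreover have "arg_min_on r {e \<in> E. v \<in> e} = m"
    using m by (simp add: least_edge_def split: if_splits)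
  ultimately show ?thesis using False by (simp add: vertex_spine_def)
qed

section \<open>Gluing along a cut vertex\<close>

text \<open>A path passes from \<open>E1\<close> to \<open>E2\<close> only at \<open>v\<close>; the
  second alternative records that \<open>v\<close> has been reached within \<open>E1\<close> and
  persists along the rest of the path.\<close>

lemma reach_Un_cut_vertex:
  assumes "\<Union>E1 \<inter> \<Union>E2 \<subseteq> {v}" "u \<in> \<Union>E1" "(u, w) \<in> reach (E1 \<union> E2) r k"
  shows "(u, w) \<in> reach E1 r k \<and> w \<in> \<Union>E1 \<or> (u, v) \<in> reach E1 r k"
  using assms(3) unfolding reach_def
proof (induction rule: rtrancl_induct)
  case base
  then show ?case using assms(2) by simp
next
  case (step y z)
  then show ?case using assms(1) by (auto intro: rtrancl_into_rtrancl)
qed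

text \<open>A cluster can gain vertices from \<open>E2\<close> only through \<open>v\<close>, so one
  that misses \<open>v\<close> stays as it is.\<close>

lemma edge_cluster_Un:
  assumes "\<Union>E1 \<inter> \<Union>E2 \<subseteq> {v}" "e \<in> E1"
  shows "v \<in> edge_cluster (E1 \<union> E2) r e \<longleftrightarrow> v \<in> edge_cluster E1 r e"
    and "v \<notin> edge_cluster E1 r e \<Longrightarrow>
      edge_cluster (E1 \<union> E2) r e = edge_cluster E1 r e \<and> edge_cluster E1 r e \<subseteq> \<Union>E1"
proof -
  have sub: "edge_cluster E1 r e \<subseteq> edge_cluster (E1 \<union> E2) r e"
    by (auto simp: edge_cluster_def intro: reach_mono)
  have cut: "w \<in> edge_cluster E1 r e \<and> w \<in> \<Union>E1 \<or> v \<in> edge_cluster E1 r e"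
    if "w \<in> edge_cluster (E1 \<union> E2) r e" for w
    using that reach_Un_cut_vertex[OF assms(1), of _ w r "r e"] assms(2)
    by (fastforce simp: edge_cluster_def)
  show "v \<in> edge_cluster (E1 \<union> E2) r e \<longleftrightarrow> v \<in> edge_cluster E1 r e"
    using sub cut by blast
  show "edge_cluster (E1 \<union> E2) r e = edge_cluster E1 r e \<and> edge_cluster E1 r e \<subseteq> \<Union>E1"
    if "v \<notin> edge_cluster E1 r e"
    using that sub cut by blast
qed

lemma edges_reaching_Un:
  assumes "\<Union>E1 \<inter> \<Union>E2 \<subseteq> {v}"
  shows "edges_reaching (E1 \<union> E2) r v = edges_reaching E1 r v \<union> edges_reaching E2 r v"
proof -
  have "\<Union>E2 \<inter> \<Union>E1 \<subseteq> {v}" using assms by blast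
  from edge_cluster_Un(1)[OF this] edge_cluster_Un(1)[OF assms] show ?thesis
    by (auto simp: edges_reaching_def Un_commute)
qed

text \<open>The cluster of \<open>e\<close> lies among the vertices of \<open>E1\<close> and misses
  \<open>v\<close>, the only vertex that an edge of \<open>E2\<close> could share with it.\<close>

lemma next_edges_Un:
  assumes "\<Union>E1 \<inter> \<Union>E2 \<subseteq> {v}" "e \<in> E1" "e \<notin> edges_reaching E1 r v"
  shows "next_edges (E1 \<union> E2) r e = next_edges E1 r e"
proof -
  have v: "v \<notin> edge_cluster E1 r e" using assms(2,3) by (simp add: edges_reaching_def)
  have "f \<inter> edge_cluster E1 r e = {}" if "f \<in> E2" for f
    using edge_cluster_Un(2)[OF assms(1,2) v] assms(1) that v by blast
  then show ?thesis
    using edge_cluster_Un(2)[OF assms(1,2) v] by (auto simp: next_edges_def)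
qed

theorem theorem3p5:
  fixes V1 V2 :: "'a set" and E1 E2 :: "'a set set" and v :: 'a and r :: "'a set \<Rightarrow> nat"
  assumes "is_tree V1 E1" and "is_tree V2 E2"
    and "V1 \<inter> V2 = {v}" and "E1 \<inter> E2 = {}"
    and "inj_on r (E1 \<union> E2)"
  shows "sld_merge V1 E1 V2 E2 r v = sld_parent (V1 \<union> V2) (E1 \<union> E2) r"
proof
  fix e
  have edges: "\<forall>e\<in>E1. e \<subseteq> V1 \<and> card e = 2" "\<forall>e\<in>E2. e \<subseteq> V2 \<and> card e = 2"
    and "finite V1" "finite V2"
    using assms(1,2) by (auto simp: is_tree_def is_simple_graph_def)
  then have fin: "finite E1" "finite E2" by (meson PowI finite_Pow_iff finite_subset subsetI)+
  have inj: "inj_on r E1" "inj_on r E2" using inj_on_subset[OF assms(5)] by auto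
  have cut: "\<Union>E1 \<inter> \<Union>E2 \<subseteq> {v}" "\<Union>E2 \<inter> \<Union>E1 \<subseteq> {v}"
    using edges assms(3) by blast+
  define S where "S = edges_reaching (E1 \<union> E2) r v"
  have "vertex_spine V1 E1 r v = edges_reaching E1 r v"
    "vertex_spine V2 E2 r v = edges_reaching E2 r v"
    using assms(1-3) inj vertex_spine_eq_edges_reaching[of _ _ r v] by (auto simp: is_tree_def)
  then have S: "vertex_spine V1 E1 r v \<union> vertex_spine V2 E2 r v = S"
    by (simp add: S_def edges_reaching_Un[OF cut(1)])
  have merge: "sld_merge V1 E1 V2 E2 r v e =
      (if e \<in> S then least_edge r {f \<in> S. r e < r f}
       else if e \<in> E1 then sld_parent V1 E1 r e
       else if e \<in> E2 then sld_parent V2 E2 r e else None)"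
    unfolding sld_merge_def S Let_def least_edge_def by auto
  have parent: "sld_parent (V1 \<union> V2) (E1 \<union> E2) r e =
      (if e \<in> E1 \<union> E2 then least_edge r (next_edges (E1 \<union> E2) r e) else None)"
    using fin edges assms(5) by (intro sld_parent_eq_least_edge) auto
  show "sld_merge V1 E1 V2 E2 r v e = sld_parent (V1 \<union> V2) (E1 \<union> E2) r e"
  proof (cases "e \<in> S")
    case True
    then have "e \<in> E1 \<union> E2" by (simp add: S_def edges_reaching_def)
    \<comment> \<open>The lemma behind the two spines applies to the glued graph as well, so
      \<open>S\<close> is a chain of successors there.\<close>
    moreover have "least_edge r (next_edges (E1 \<union> E2) r e) = least_edge r {f \<in> S. r e < r f}"
      using True fin edges assms(5) unfolding S_def by (intro next_edge_edges_reaching) auto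
    ultimately show ?thesis using True by (simp add: merge parent)
  next
    case False
    then have notin: "e \<notin> edges_reaching E1 r v" "e \<notin> edges_reaching E2 r v"
      by (auto simp: S_def edges_reaching_Un[OF cut(1)])
    have "next_edges (E1 \<union> E2) r e = next_edges E1 r e" if "e \<in> E1"
      using next_edges_Un[OF cut(1) that notin(1)] .
    moreover have "next_edges (E1 \<union> E2) r e = next_edges E2 r e" if "e \<in> E2" "e \<notin> E1"
      using next_edges_Un[OF cut(2) that(1) notin(2)] by (simp add: Un_commute)
    ultimately show ?thesis
      using False by (simp add: merge parent sld_parent_eq_least_edge[OF fin(1) edges(1) inj(1)]
        sld_parent_eq_least_edge[OF fin(2) edges(2) inj(2)])
  qed
qed

end
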